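(* Let $T$ be a subresiduated Nelson algebra. The following conditions are equivalent: 1) $T$ is simple. 2) For every $x\in T$, if $x\neq 1$ then $\square(x)\to 0=1$, where $\square(x)=1\to x$.
   Context: A Kleene algebra is a bounded distributive lattice $\langle T,\wedge,\vee,0,1\rangle$ with a unary operation $\sim$ satisfying $\sim\sim x=x$, $\sim(x\wedge y)=\sim x\vee\sim y$, $(x\wedge\sim x)\wedge(y\vee\sim y)=x\wedge\sim x$. A subresiduated Nelson algebra is an algebra $\langle T,\wedge,\vee,\to,\sim,0,1\rangle$ of type $(2,2,2,1,0,0)$ such that $\langle T,\wedge,\vee,\sim,0,1\rangle$ is a Kleene algebra and for all $x,y,z\in T$: (1) $(x\vee y)\to z=(x\to z)\wedge(y\to z)$; (2) $z\to(x\wedge y)=(z\to x)\wedge(z\to y)$; (3) $((x\to y)\wedge(y\to z))\to(x\to z)=1$; (4) $x\to x=1$; (5) $x\wedge(x\to y)\le x\wedge(\sim x\vee y)$; (6) $x\to y\le z\to(x\to y)$; (7) $\sim(x\to y)\to(x\wedge\sim y)=1$; (8) $(x\wedge\sim y)\to\sim(x\to y)=1$. An algebra $T$ is simple if its only congruences are the identity relation and the total relation $T\times T$ (with this convention a one-element algebra counts as simple). *)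

theory Defs
  imports Main
begin

unbundle lattice_syntax

class kleene_algebra = distrib_lattice + bounded_lattice +
  fixes kneg :: "'a \<Rightarrow> 'a"  ("\<sim> _" [81] 80)
  assumes kneg_kneg: "\<sim> (\<sim> x) = x"
    and kneg_inf: "\<sim> (x \<sqinter> y) = \<sim> x \<squnion> \<sim> y"
    and kleene: "(x \<sqinter> \<sim> x) \<sqinter> (y \<squnion> \<sim> y) = x \<sqinter> \<sim> x"

class subresiduated_nelson_algebra = kleene_algebra +
  fixes nimp :: "'a \<Rightarrow> 'a \<Rightarrow> 'a"  (infixr "\<rightarrow>" 60)
  assumes sup_nimp: "((x \<squnion> y) \<rightarrow> z) = (x \<rightarrow> z) \<sqinter> (y \<rightarrow> z)"
    and nimp_inf: "(z \<rightarrow> (x \<sqinter> y)) = (z \<rightarrow> x) \<sqinter> (z \<rightarrow> y)"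
    and nimp_trans: "(((x \<rightarrow> y) \<sqinter> (y \<rightarrow> z)) \<rightarrow> (x \<rightarrow> z)) = \<top>"
    and nimp_refl: "(x \<rightarrow> x) = \<top>"
    and inf_nimp_le: "x \<sqinter> (x \<rightarrow> y) \<le> x \<sqinter> (\<sim> x \<squnion> y)"
    and nimp_le_nimp: "(x \<rightarrow> y) \<le> (z \<rightarrow> (x \<rightarrow> y))"
    and kneg_nimp_1: "(\<sim> (x \<rightarrow> y) \<rightarrow> (x \<sqinter> \<sim> y)) = \<top>"
    and kneg_nimp_2: "((x \<sqinter> \<sim> y) \<rightarrow> \<sim> (x \<rightarrow> y)) = \<top>"

definition box :: "'a::subresiduated_nelson_algebra \<Rightarrow> 'a"  ("\<box> _" [81] 80) where
  "\<box> x = (\<top> \<rightarrow> x)"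

definition congruence :: "('a::subresiduated_nelson_algebra \<times> 'a) set \<Rightarrow> bool" where
  "congruence R \<longleftrightarrow> equiv UNIV R \<and>
     (\<forall>x x'. (x, x') \<in> R \<longrightarrow> (\<sim> x, \<sim> x') \<in> R) \<and>
     (\<forall>x x' y y'. (x, x') \<in> R \<longrightarrow> (y, y') \<in> R \<longrightarrow>
        (x \<sqinter> y, x' \<sqinter> y') \<in> R \<and> (x \<squnion> y, x' \<squnion> y') \<in> R \<and> (x \<rightarrow> y, x' \<rightarrow> y') \<in> R)"

text \<open>The algebra is the whole type, passed as a type argument. One-element algebras are
  simple under this definition.\<close>

definition simple_algebra :: "'a::subresiduated_nelson_algebra itself \<Rightarrow> bool" where
  "simple_algebra _ \<longleftrightarrow>
     (\<forall>R :: ('a \<times> 'a) set. congruence R \<longrightarrow> R = Id \<or> R = UNIV \<times> UNIV)"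

end

theory Submission
  imports Defs
begin

text \<open>
  Write \<open>a \<sqsubseteq> b\<close> for \<open>a \<rightarrow> b = \<top>\<close>. This is a preorder, coarser than the lattice order, and
  \<open>a \<le> b\<close> holds exactly when both \<open>a \<sqsubseteq> b\<close> and \<open>\<sim> b \<sqsubseteq> \<sim> a\<close>. In the picture of a Nelson
  algebra as an algebra of pairs (an element together with a disjoint counter-element),
  \<open>\<sqsubseteq>\<close> compares first components and \<open>\<sim>\<close> swaps the two components. On first components,
  \<open>\<rightarrow>\<close> behaves like the implication of a subresiduated lattice: modus ponens
  \<open>a \<sqinter> (a \<rightarrow> b) \<sqsubseteq> b\<close> holds for all elements, and the converse passage from \<open>d \<sqinter> a \<sqsubseteq> b\<close> to
  \<open>d \<sqsubseteq> a \<rightarrow> b\<close> holds for those \<open>d\<close> with \<open>\<box> d = d\<close>.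

  If the algebra is simple and \<open>x \<noteq> \<top>\<close>, put \<open>u = \<box> x\<close>. Comparing \<open>a\<close> with \<open>b\<close>, and \<open>\<sim> a\<close>
  with \<open>\<sim> b\<close>, modulo \<open>u\<close> (that is, through \<open>u \<sqinter> a \<sqsubseteq> b\<close> and its three companions) gives a
  congruence; compatibility with \<open>\<rightarrow>\<close> is residuation, and this is where \<open>\<box> u = u\<close> enters.
  The congruence identifies \<open>u\<close> with \<open>\<top>\<close>, and \<open>u \<le> x \<noteq> \<top>\<close>, so it is not the identity. Hence
  it is total and identifies \<open>\<top>\<close> with \<open>\<bottom>\<close>, which says \<open>u \<sqsubseteq> \<bottom>\<close>.

  Conversely, let a congruence identify \<open>a \<noteq> b\<close>. It identifies the four implications
  between \<open>a\<close> and \<open>b\<close> and between \<open>\<sim> a\<close> and \<open>\<sim> b\<close> with \<open>\<top>\<close>, and since \<open>a \<noteq> b\<close> at least one of them is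
  some \<open>z \<noteq> \<top>\<close>. Then \<open>\<top> = \<box> z \<rightarrow> \<bottom>\<close> is congruent to \<open>\<box> \<top> \<rightarrow> \<bottom> = \<bottom>\<close>, so the congruence is total.
\<close>

section \<open>The preorder of first components\<close>

definition entails :: "'a::subresiduated_nelson_algebra \<Rightarrow> 'a \<Rightarrow> bool"  (infix "\<sqsubseteq>" 50) where
  "a \<sqsubseteq> b \<longleftrightarrow> (a \<rightarrow> b) = \<top>"

lemma kneg_top: "\<sim> (\<top>::'a::kleene_algebra) = \<bottom>"
proof -
  have "\<sim> (\<top> \<sqinter> \<sim> \<bottom>) = \<sim> (\<top>::'a) \<squnion> \<bottom>"
    by (simp only: kneg_inf kneg_kneg)
  then show ?thesis by (simp add: kneg_kneg)
qed

lemma kneg_sup: "\<sim> (x \<squnion> y) = \<sim> x \<sqinter> \<sim> (y::'a::kleene_algebra)"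
  by (metis kneg_inf kneg_kneg)

lemma nimp_mono: "b \<le> c \<Longrightarrow> (a \<rightarrow> b) \<le> (a \<rightarrow> (c::'a::subresiduated_nelson_algebra))"
  by (metis nimp_inf inf.absorb1 inf.cobounded2)

lemma nimp_antimono: "a \<le> b \<Longrightarrow> (b \<rightarrow> c) \<le> (a \<rightarrow> (c::'a::subresiduated_nelson_algebra))"
  by (metis sup_nimp sup.absorb2 inf.cobounded1)

lemma entails_if_le: "a \<le> b \<Longrightarrow> a \<sqsubseteq> b"
  unfolding entails_def by (metis nimp_mono nimp_refl top_unique)

lemma box_le: "\<box> x \<le> x"
  using inf_nimp_le[of \<top> x] by (simp add: box_def kneg_top)

text \<open>In general \<open>a \<sqsubseteq> b\<close> only yields \<open>a \<le> \<sim> a \<squnion> b\<close>; for \<open>a = \<top>\<close> the summand \<open>\<sim> a\<close> vanishes.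
  This case suffices to chain entailments, because the transitivity axiom then reads
  \<open>\<top> \<sqsubseteq> (a \<rightarrow> c)\<close>.\<close>

lemma top_entails_iff: "\<top> \<sqsubseteq> x \<longleftrightarrow> x = \<top>"
  using box_le[of x] by (auto simp: box_def entails_def nimp_refl top_unique)

lemma entails_trans:
  assumes "a \<sqsubseteq> b" "b \<sqsubseteq> c"
  shows "a \<sqsubseteq> c"
  using nimp_trans[of a b c] assms top_entails_iff[of "a \<rightarrow> c"] by (simp add: entails_def)

lemma entails_inf_iff: "a \<sqsubseteq> b \<sqinter> c \<longleftrightarrow> a \<sqsubseteq> b \<and> a \<sqsubseteq> c"
  by (simp add: entails_def nimp_inf)

lemma sup_entails_iff: "a \<squnion> b \<sqsubseteq> c \<longleftrightarrow> a \<sqsubseteq> c \<and> b \<sqsubseteq> c"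
  by (simp add: entails_def sup_nimp)

text \<open>First and second components are disjoint. This comes from the description of \<open>\<sim> (a \<rightarrow> a)\<close>
  as \<open>a \<sqinter> \<sim> a\<close>, in view of \<open>a \<rightarrow> a = \<top>\<close>.\<close>

lemma inf_kneg_entails: "a \<sqinter> \<sim> a \<sqsubseteq> b"
proof -
  have "a \<sqinter> \<sim> a \<sqsubseteq> \<bottom>"
    using kneg_nimp_2[of a a] by (simp add: entails_def nimp_refl kneg_top)
  then show ?thesis by (rule entails_trans) (simp add: entails_if_le)
qed

lemma modus_ponens: "a \<sqinter> (a \<rightarrow> b) \<sqsubseteq> b"
proof -
  have "a \<sqinter> (a \<rightarrow> b) \<sqsubseteq> (a \<sqinter> \<sim> a) \<squnion> (a \<sqinter> b)"
    by (rule entails_if_le) (metis inf_nimp_le inf_sup_distrib1)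
  moreover have "(a \<sqinter> \<sim> a) \<squnion> (a \<sqinter> b) \<sqsubseteq> b"
    by (simp add: sup_entails_iff inf_kneg_entails entails_if_le)
  ultimately show ?thesis by (rule entails_trans)
qed

lemma box_nimp: "\<box> (a \<rightarrow> b) = (a \<rightarrow> b)"
  using box_le[of "a \<rightarrow> b"] nimp_le_nimp[of a b \<top>] by (simp add: box_def antisym)

lemma box_inf: "\<box> (a \<sqinter> b) = \<box> a \<sqinter> \<box> b"
  by (simp add: box_def nimp_inf)

text \<open>For \<open>d = \<top> \<rightarrow> d\<close> antitonicity gives \<open>d \<le> a \<rightarrow> d\<close>, and \<open>a \<rightarrow> d\<close> is the same as
  \<open>a \<rightarrow> (d \<sqinter> a)\<close>; transitivity then carries this on to \<open>a \<rightarrow> b\<close>.\<close>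

lemma residuation:
  assumes "\<box> d = d" and "d \<sqinter> a \<sqsubseteq> b"
  shows "d \<sqsubseteq> (a \<rightarrow> b)"
proof -
  have "d \<le> (a \<rightarrow> d)"
    using nimp_antimono[of a \<top> d] assms(1) by (simp add: box_def)
  then have "d \<sqsubseteq> (a \<rightarrow> (d \<sqinter> a))"
    by (simp add: entails_if_le nimp_inf nimp_refl)
  moreover have "(a \<rightarrow> (d \<sqinter> a)) \<sqsubseteq> (a \<rightarrow> b)"
    using nimp_trans[of a "d \<sqinter> a" b] assms(2) by (simp add: entails_def)
  ultimately show ?thesis by (rule entails_trans)
qed

text \<open>The part of \<open>a\<close> lying below \<open>\<sim> a\<close> is what \<open>a \<sqsubseteq> b\<close> fails to control: it only yields
  \<open>a \<le> \<sim> a \<squnion> b\<close>. The Kleene inequality puts \<open>a \<sqinter> \<sim> a\<close> below \<open>b \<squnion> \<sim> b\<close>, and the second entailment,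
  dualised to \<open>a \<sqinter> \<sim> b \<le> b\<close>, disposes of the summand \<open>\<sim> b\<close>.\<close>

lemma le_if_entails:
  assumes "a \<sqsubseteq> b" and "\<sim> b \<sqsubseteq> \<sim> a"
  shows "a \<le> b"
proof -
  have 1: "a \<le> \<sim> a \<squnion> b"
    using inf_nimp_le[of a b] assms(1) by (simp add: entails_def)
  have "\<sim> b \<le> b \<squnion> \<sim> a"
    using inf_nimp_le[of "\<sim> b" "\<sim> a"] assms(2) by (simp add: entails_def kneg_kneg)
  then have "\<sim> (b \<squnion> \<sim> a) \<le> b"
    by (metis inf.cobounded1 kneg_kneg kneg_sup sup.absorb_iff2)
  then have 2: "a \<sqinter> \<sim> b \<le> b"
    by (simp add: kneg_sup kneg_kneg inf_commute)
  have "a \<sqinter> \<sim> a = (a \<sqinter> \<sim> a \<sqinter> b) \<squnion> (a \<sqinter> \<sim> a \<sqinter> \<sim> b)"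
    using kleene[of a b] by (simp add: inf_sup_distrib1)
  also have "\<dots> \<le> b"
  proof (rule le_supI)
    show "a \<sqinter> \<sim> a \<sqinter> b \<le> b" by simp
    have "a \<sqinter> \<sim> a \<sqinter> \<sim> b \<le> a \<sqinter> \<sim> b" by (simp add: le_infI1)
    then show "a \<sqinter> \<sim> a \<sqinter> \<sim> b \<le> b" using 2 by (rule order_trans)
  qed
  finally have 3: "a \<sqinter> \<sim> a \<le> b" .
  have "a = (a \<sqinter> \<sim> a) \<squnion> (a \<sqinter> b)"
    using 1 by (metis inf.absorb1 inf_sup_distrib1)
  also have "\<dots> \<le> b" using 3 by simp
  finally show ?thesis .
qed

section \<open>The congruence of a box element\<close>

definition entails_mod :: "'a::subresiduated_nelson_algebra \<Rightarrow> 'a \<Rightarrow> 'a \<Rightarrow> bool" where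
  "entails_mod u a b \<longleftrightarrow> u \<sqinter> a \<sqsubseteq> b"

definition congruence_mod :: "'a::subresiduated_nelson_algebra \<Rightarrow> ('a \<times> 'a) set" where
  "congruence_mod u = {(a, b). entails_mod u a b \<and> entails_mod u b a \<and>
     entails_mod u (\<sim> a) (\<sim> b) \<and> entails_mod u (\<sim> b) (\<sim> a)}"

lemma entails_mod_if_entails: "a \<sqsubseteq> b \<Longrightarrow> entails_mod u a b"
  unfolding entails_mod_def by (rule entails_trans[OF entails_if_le[OF inf.cobounded2]])

lemma entails_mod_if_le: "a \<le> b \<Longrightarrow> entails_mod u a b"
  by (simp add: entails_mod_if_entails entails_if_le)

lemma entails_mod_trans [trans]:
  assumes "entails_mod u a b" "entails_mod u b c"
  shows "entails_mod u a c"
proof -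
  have "u \<sqinter> a \<sqsubseteq> u \<sqinter> b"
    using assms(1) by (simp add: entails_mod_def entails_inf_iff entails_if_le)
  then show ?thesis
    using assms(2) unfolding entails_mod_def by (rule entails_trans)
qed

lemma entails_mod_inf_iff: "entails_mod u a (b \<sqinter> c) \<longleftrightarrow> entails_mod u a b \<and> entails_mod u a c"
  by (simp add: entails_mod_def entails_inf_iff)

lemma entails_mod_sup_iff: "entails_mod u (a \<squnion> b) c \<longleftrightarrow> entails_mod u a c \<and> entails_mod u b c"
  by (simp add: entails_mod_def sup_entails_iff inf_sup_distrib1)

lemma entails_mod_inf:
  assumes "entails_mod u a a'" "entails_mod u b b'"
  shows "entails_mod u (a \<sqinter> b) (a' \<sqinter> b')"
  using assms
  unfolding entails_mod_inf_iff
  by (blast intro: entails_mod_trans[OF entails_mod_if_le] inf.cobounded1 inf.cobounded2)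

lemma entails_mod_sup:
  assumes "entails_mod u a a'" "entails_mod u b b'"
  shows "entails_mod u (a \<squnion> b) (a' \<squnion> b')"
  using assms
  unfolding entails_mod_sup_iff
  by (blast intro: entails_mod_trans[OF _ entails_mod_if_le] sup.cobounded1 sup.cobounded2)

text \<open>Residuation applies because \<open>u \<sqinter> (a \<rightarrow> b)\<close> is again fixed by \<open>\<box>\<close>; what remains is to chain
  \<open>a'\<close> to \<open>a\<close>, to \<open>b\<close> by modus ponens, and to \<open>b'\<close>.\<close>

lemma entails_mod_nimp:
  assumes u: "\<box> u = u" and a: "entails_mod u a' a" and b: "entails_mod u b b'"
  shows "entails_mod u (a \<rightarrow> b) (a' \<rightarrow> b')"
proof -
  have "entails_mod u (a' \<sqinter> (a \<rightarrow> b)) (a \<sqinter> (a \<rightarrow> b))"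
    using a by (rule entails_mod_inf) (simp add: entails_mod_if_le)
  also have "entails_mod u (a \<sqinter> (a \<rightarrow> b)) b"
    by (rule entails_mod_if_entails[OF modus_ponens])
  also note b
  finally have "u \<sqinter> (a \<rightarrow> b) \<sqinter> a' \<sqsubseteq> b'"
    by (simp add: entails_mod_def inf.assoc inf.commute inf.left_commute)
  then show ?thesis
    unfolding entails_mod_def by (intro residuation) (simp_all add: box_inf box_nimp u)
qed

text \<open>The two axioms on \<open>\<sim> (x \<rightarrow> y)\<close> reduce compatibility of the second components with \<open>\<rightarrow>\<close> to
  compatibility with \<open>\<sqinter>\<close>.\<close>

lemma entails_mod_kneg_nimp:
  assumes "entails_mod u a a'" "entails_mod u (\<sim> b) (\<sim> b')"
  shows "entails_mod u (\<sim> (a \<rightarrow> b)) (\<sim> (a' \<rightarrow> b'))"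
proof -
  have "entails_mod u (\<sim> (a \<rightarrow> b)) (a \<sqinter> \<sim> b)"
    by (rule entails_mod_if_entails) (simp add: entails_def kneg_nimp_1)
  also have "entails_mod u (a \<sqinter> \<sim> b) (a' \<sqinter> \<sim> b')"
    using assms by (rule entails_mod_inf)
  also have "entails_mod u (a' \<sqinter> \<sim> b') (\<sim> (a' \<rightarrow> b'))"
    by (rule entails_mod_if_entails) (simp add: entails_def kneg_nimp_2)
  finally show ?thesis .
qed

lemma congruence_congruence_mod:
  assumes "\<box> u = u"
  shows "congruence (congruence_mod u)"
proof -
  have "equiv UNIV (congruence_mod u)"
  proof (rule equivI)
    show "refl (congruence_mod u)"
      by (auto simp: refl_on_def congruence_mod_def entails_mod_if_le)
    show "sym (congruence_mod u)"
      by (auto simp: sym_def congruence_mod_def)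
    show "trans (congruence_mod u)"
      unfolding trans_def congruence_mod_def
      by (clarsimp; intro conjI; erule entails_mod_trans, assumption)
  qed simp
  moreover have "(\<sim> a, \<sim> a') \<in> congruence_mod u" if "(a, a') \<in> congruence_mod u" for a a'
    using that by (simp add: congruence_mod_def kneg_kneg)
  moreover have "(a \<sqinter> b, a' \<sqinter> b') \<in> congruence_mod u \<and>
      (a \<squnion> b, a' \<squnion> b') \<in> congruence_mod u \<and> (a \<rightarrow> b, a' \<rightarrow> b') \<in> congruence_mod u"
    if "(a, a') \<in> congruence_mod u" "(b, b') \<in> congruence_mod u" for a a' b b'
    using that assms
    by (simp add: congruence_mod_def kneg_inf kneg_sup entails_mod_inf entails_mod_sup
        entails_mod_nimp entails_mod_kneg_nimp)
  ultimately show ?thesis unfolding congruence_def by blast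
qed

lemma congruence_mod_top: "(u, \<top>) \<in> congruence_mod u"
  by (simp add: congruence_mod_def entails_mod_def kneg_top inf_kneg_entails entails_if_le)

section \<open>Simplicity\<close>

lemma congruence_refl: "congruence R \<Longrightarrow> (a, a) \<in> R"
  by (simp add: congruence_def equiv_def refl_on_def)

lemma congruence_sym: "congruence R \<Longrightarrow> (a, b) \<in> R \<Longrightarrow> (b, a) \<in> R"
  unfolding congruence_def equiv_def by (blast dest: symD)

lemma congruence_trans: "congruence R \<Longrightarrow> (a, b) \<in> R \<Longrightarrow> (b, c) \<in> R \<Longrightarrow> (a, c) \<in> R"
  unfolding congruence_def equiv_def by (blast dest: transD)

lemma congruence_kneg: "congruence R \<Longrightarrow> (a, b) \<in> R \<Longrightarrow> (\<sim> a, \<sim> b) \<in> R"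
  unfolding congruence_def by blast

lemma congruence_inf:
  "congruence R \<Longrightarrow> (a, a') \<in> R \<Longrightarrow> (b, b') \<in> R \<Longrightarrow> (a \<sqinter> b, a' \<sqinter> b') \<in> R"
  unfolding congruence_def by blast

lemma congruence_nimp:
  "congruence R \<Longrightarrow> (a, a') \<in> R \<Longrightarrow> (b, b') \<in> R \<Longrightarrow> (a \<rightarrow> b, a' \<rightarrow> b') \<in> R"
  unfolding congruence_def by blast

lemma congruence_total_if_top_bottom:
  assumes R: "congruence R" and "(\<top>, \<bottom>) \<in> R"
  shows "R = UNIV \<times> UNIV"
proof -
  have bot: "(x, \<bottom>) \<in> R" for x
    using congruence_inf[OF R congruence_refl[OF R, of x] assms(2)] by simp
  have "(x, y) \<in> R" for x y
    by (rule congruence_trans[OF R bot congruence_sym[OF R bot]])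
  then show ?thesis by auto
qed

text \<open>By antisymmetry, two congruent elements are equal as soon as the implications witnessing
  \<open>a \<le> b\<close> and \<open>b \<le> a\<close> are \<open>\<top>\<close>, and these are all congruent to \<open>b \<rightarrow> b = \<top>\<close> or its analogues. So
  a congruence is the identity once its class of \<open>\<top>\<close> is trivial.\<close>

lemma congruence_eq_Id:
  fixes R :: "('a::subresiduated_nelson_algebra \<times> 'a) set"
  assumes R: "congruence R" and top: "\<And>z. (z, \<top>) \<in> R \<Longrightarrow> z = \<top>"
  shows "R = Id"
proof -
  have entails: "a \<sqsubseteq> b" if "(a, b) \<in> R" for a b
    using congruence_nimp[OF R that congruence_refl[OF R, of b]]
    by (simp add: entails_def nimp_refl top)
  have le: "a \<le> b" if "(a, b) \<in> R" for a b
    by (rule le_if_entails[OF entails[OF that]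
          entails[OF congruence_kneg[OF R congruence_sym[OF R that]]]])
  have "a = b" if "(a, b) \<in> R" for a b
    using le[OF that] le[OF congruence_sym[OF R that]] by (rule antisym)
  then show ?thesis using congruence_refl[OF R] by auto
qed

theorem proposition4p13:
  "simple_algebra TYPE('a::subresiduated_nelson_algebra) \<longleftrightarrow>
     (\<forall>x::'a. x \<noteq> \<top> \<longrightarrow> (\<box> x \<rightarrow> \<bottom>) = \<top>)"
proof
  assume simple: "simple_algebra TYPE('a)"
  show "\<forall>x::'a. x \<noteq> \<top> \<longrightarrow> (\<box> x \<rightarrow> \<bottom>) = \<top>"
  proof (intro allI impI)
    fix x :: 'a
    assume x: "x \<noteq> \<top>"
    have "congruence (congruence_mod (\<box> x))"
      by (rule congruence_congruence_mod) (simp add: box_def[of x] box_nimp)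
    moreover have "congruence_mod (\<box> x) \<noteq> Id"
      using congruence_mod_top[of "\<box> x"] box_le[of x] x by (auto simp: top_unique)
    ultimately have "(\<top>, \<bottom>) \<in> congruence_mod (\<box> x)"
      using simple by (auto simp: simple_algebra_def)
    then show "(\<box> x \<rightarrow> \<bottom>) = \<top>"
      by (simp add: congruence_mod_def entails_mod_def entails_def)
  qed
next
  assume cond: "\<forall>x::'a. x \<noteq> \<top> \<longrightarrow> (\<box> x \<rightarrow> \<bottom>) = \<top>"
  have "R = UNIV \<times> UNIV" if R: "congruence R" and "R \<noteq> Id" for R :: "('a \<times> 'a) set"
  proof (rule congruence_total_if_top_bottom[OF R])
    obtain z where z: "(z, \<top>) \<in> R" "z \<noteq> \<top>"
      using congruence_eq_Id[OF R] \<open>R \<noteq> Id\<close> by blast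
    have "(\<box> z \<rightarrow> \<bottom>, \<box> \<top> \<rightarrow> \<bottom>) \<in> R"
      unfolding box_def by (intro congruence_nimp[OF R] congruence_refl[OF R] z)
    moreover have "(\<box> \<top> \<rightarrow> \<bottom>) = (\<bottom>::'a)"
      using box_le[of "\<bottom>::'a"] by (simp add: box_def nimp_refl bot_unique)
    ultimately show "(\<top>, \<bottom>) \<in> R"
      using cond z(2) by simp
  qed
  then show "simple_algebra TYPE('a)"
    unfolding simple_algebra_def by blast
qed

end
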